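(* Let $A=(\Sigma,Q,\delta,I)$ be a top-down tree automaton. For every strict partial order $R\subset{\subseteq^{\mathsf{dw}}}$ on $Q$, where $\subseteq^{\mathsf{dw}}$ is the downward trace inclusion preorder on $A$, the relation $P(\mathrm{id},R)$ is good for pruning, i.e. $L(\mathrm{Prune}(A,P(\mathrm{id},R)))=L(A)$.
   Context: **Trees.** A ranked alphabet $\Sigma$ is a set of symbols with a rank function $\#:\Sigma\to\mathbb N_0$. Nodes are finite sequences of positive integers; $\varepsilon$ is the empty sequence. A tree over $\Sigma$ is a partial map $t$ from nodes to $\Sigma$ with finite nonempty domain such that if $vi\in\mathrm{dom}(t)$ ($i\ge1$) then $v\in\mathrm{dom}(t)$ and $i\le\#(t(v))$. A leaf of $t$ is a node of $\mathrm{dom}(t)$ without children in $\mathrm{dom}(t)$. A tree is closed if every $v\in\mathrm{dom}(t)$ has exactly $\#(t(v))$ children in $\mathrm{dom}(t)$. **Automata.** A top-down tree automaton is $A=(\Sigma,Q,\delta,I)$ with $Q$ a finite set of states, $I\subseteq Q$ the initial states, a unique final state $\psi\in Q$ which has no outgoing transitions, and $\delta\subseteq Q\times\Sigma\times Q^+$ a set of transitions, each of the form $\langle q,a,\psi\rangle$ with $\#(a)=0$ or $\langle q,a,q_1\dots q_n\rangle$ with $n=\#(a)\ge1$. A run of $A$ on a tree $t$ (a $t$-run) is a map $\pi$ to $Q$ with domain $\mathrm{dom}(t)\cup\{vi: v\in\mathrm{dom}(t),1\le i\le\#(t(v))\}$ such that for every $v\in\mathrm{dom}(t)$: if $\#(t(v))=0$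 then $\langle\pi(v),t(v),\psi\rangle\in\delta$, and if $n=\#(t(v))\ge1$ then $\langle\pi(v),t(v),\pi(v1)\dots\pi(vn)\rangle\in\delta$. The language $L(A)$ is the set of closed trees $t$ having a $t$-run $\pi$ with $\pi(\varepsilon)\in I$. **Downward trace inclusion.** $q\subseteq^{\mathsf{dw}}r$ iff for every closed tree $t$ and every $t$-run $\pi_q$ with $\pi_q(\varepsilon)=q$ there is a $t$-run $\pi_r$ with $\pi_r(\varepsilon)=r$ and such that ($\pi_q(v)=\psi\Rightarrow\pi_r(v)=\psi$) for each leaf $v\in\mathrm{dom}(t)$. (In top-down tree automata this coincides with downward language inclusion: every closed tree having a run with root state $q$ has a run with root state $r$.) **Pruning.** A strict partial order is an irreflexive transitive relation. A strict partial order $<_{\mathsf d}$ on $Q$ is understood as the strict version ${\le_{\mathsf d}}\setminus{\le_{\mathsf d}^{-1}}$ of an associated non-strict order (preorder) $\le_{\mathsf d}$, and is lifted to tuples by: $(r_1,\dots,r_n)\,\hat<_{\mathsf d}\,(r'_1,\dots,r'_n)$ iff $r_i\le_{\mathsf d}r'_i$ for all $i$ and $r_i<_{\mathsf d}r'_i$ for some $i$. For $R$ as in the claim, the associated non-strict order is any preorder contained in $\subseteq^{\mathsf{dw}}$ whose strict version is $R$ (for instance, $\subseteq^{\mathsf{dw}}$ itself when $R={\subseteq^{\mathsf{dw}}}\setminus(\subseteq^{\mathsf{dw}})^{-1}$, or the reflexive closure of $R$); $\hat R$ is the resulting lifting. $P(\mathrm{id},R)$ is the set of pairs of transitions $(\langle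 p,\sigma,r_1\dots r_n\rangle,\langle p',\sigma,r'_1\dots r'_n\rangle)\in\delta\times\delta$ with $p=p'$ and $(r_1,\dots,r_n)\,\hat R\,(r'_1,\dots,r'_n)$. For a strict partial order $P$ on $\delta$, $\mathrm{Prune}(A,P)=(\Sigma,Q,\delta',I)$ where $\delta'$ is the set of $\tau\in\delta$ for which there is no $\tau'\in\delta$ with $\tau\,P\,\tau'$. $P$ is good for pruning iff $L(\mathrm{Prune}(A,P))=L(A)$. *)

theory Defs
  imports Main
begin

text \<open>Ranked trees are partial maps from nodes, i.e. finite sequences of positive integers.
  Child \<open>i\<close> of the node \<open>v\<close> is \<open>v @ [i]\<close>, and children are counted from \<open>1\<close>.\<close>

type_synonym node = "nat list"
type_synonym 'a tree = "node \<rightharpoonup> 'a"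

definition is_tree :: "'a set \<Rightarrow> ('a \<Rightarrow> nat) \<Rightarrow> 'a tree \<Rightarrow> bool" where
  "is_tree \<Sigma> rk t \<longleftrightarrow>
     finite (dom t) \<and> dom t \<noteq> {} \<and> dom t \<subseteq> lists {1..} \<and> ran t \<subseteq> \<Sigma> \<and>
     (\<forall>v i. v @ [i] \<in> dom t \<longrightarrow> v \<in> dom t \<and> i \<le> rk (the (t v)))"

definition leaf :: "'a tree \<Rightarrow> node \<Rightarrow> bool" where
  "leaf t v \<longleftrightarrow> v \<in> dom t \<and> (\<forall>i. v @ [i] \<notin> dom t)"

definition closed_tree :: "'a set \<Rightarrow> ('a \<Rightarrow> nat) \<Rightarrow> 'a tree \<Rightarrow> bool" where
  "closed_tree \<Sigma> rk t \<longleftrightarrow>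
     is_tree \<Sigma> rk t \<and> (\<forall>v \<in> dom t. card {i. v @ [i] \<in> dom t} = rk (the (t v)))"

type_synonym ('q, 'a) transition = "'q \<times> 'a \<times> 'q list"

record ('q, 'a) ta =
  alphabet :: "'a set"
  arity :: "'a \<Rightarrow> nat"
  states :: "'q set"
  trans_rules :: "('q, 'a) transition set"
  initial :: "'q set"
  final :: 'q

definition top_down_ta :: "('q, 'a) ta \<Rightarrow> bool" where
  "top_down_ta A \<longleftrightarrow>
     finite (states A) \<and> initial A \<subseteq> states A \<and> final A \<in> states A \<and>
     (\<forall>(q, a, qs) \<in> trans_rules A.
        q \<in> states A \<and> q \<noteq> final A \<and> a \<in> alphabet A \<and> set qs \<subseteq> states A \<and>
        (if arity A a = 0 then qs = [final A] else length qs = arity A a))"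

text \<open>The domain of a run also contains the missing children of the nodes of a non-closed tree.\<close>

definition is_run :: "('q, 'a) ta \<Rightarrow> 'a tree \<Rightarrow> (node \<rightharpoonup> 'q) \<Rightarrow> bool" where
  "is_run A t \<pi> \<longleftrightarrow>
     dom \<pi> = dom t \<union> {v @ [i] | v i. v \<in> dom t \<and> 1 \<le> i \<and> i \<le> arity A (the (t v))} \<and>
     ran \<pi> \<subseteq> states A \<and>
     (\<forall>v \<in> dom t. let a = the (t v); n = arity A a in
        if n = 0 then (the (\<pi> v), a, [final A]) \<in> trans_rules A
        else (the (\<pi> v), a, map (\<lambda>i. the (\<pi> (v @ [i]))) [1..<Suc n]) \<in> trans_rules A)"

definition language :: "('q, 'a) ta \<Rightarrow> 'a tree set" where
  "language A = {t. closed_tree (alphabet A) (arity A) t \<and>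
                    (\<exists>\<pi> q. is_run A t \<pi> \<and> \<pi> [] = Some q \<and> q \<in> initial A)}"

definition dw_trace_incl :: "('q, 'a) ta \<Rightarrow> 'q rel" where
  "dw_trace_incl A = {(q, r). q \<in> states A \<and> r \<in> states A \<and>
     (\<forall>t \<pi>. closed_tree (alphabet A) (arity A) t \<and> is_run A t \<pi> \<and> \<pi> [] = Some q \<longrightarrow>
        (\<exists>\<pi>'. is_run A t \<pi>' \<and> \<pi>' [] = Some r \<and>
           (\<forall>v. leaf t v \<longrightarrow> \<pi> v = Some (final A) \<longrightarrow> \<pi>' v = Some (final A))))}"

definition strict_partial_order_on :: "'q set \<Rightarrow> 'q rel \<Rightarrow> bool" where
  "strict_partial_order_on Q R \<longleftrightarrow> R \<subseteq> Q \<times> Q \<and> irrefl R \<and> trans R"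

text \<open>\<open>D\<close> is a non-strict order associated with the strict order \<open>R\<close>. In general it is not
  determined by \<open>R\<close>, so the lifting to tuples and the relation on transitions depend on both.\<close>

definition associated_preorder_on :: "'q set \<Rightarrow> 'q rel \<Rightarrow> 'q rel \<Rightarrow> bool" where
  "associated_preorder_on Q R D \<longleftrightarrow> preorder_on Q D \<and> R = D - D\<inverse>"

definition tuple_lift :: "'q rel \<Rightarrow> 'q rel \<Rightarrow> 'q list rel" where
  "tuple_lift R D = {(rs, rs'). length rs = length rs' \<and>
     (\<forall>i < length rs. (rs ! i, rs' ! i) \<in> D) \<and>
     (\<exists>i < length rs. (rs ! i, rs' ! i) \<in> R)}"

definition P_id :: "('q, 'a) ta \<Rightarrow> 'q rel \<Rightarrow> 'q rel \<Rightarrow> ('q, 'a) transition rel" where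
  "P_id A R D = {((p, a, rs), (p', a', rs')).
     (p, a, rs) \<in> trans_rules A \<and> (p', a', rs') \<in> trans_rules A \<and>
     p = p' \<and> a = a' \<and> (rs, rs') \<in> tuple_lift R D}"

definition Prune :: "('q, 'a) ta \<Rightarrow> ('q, 'a) transition rel \<Rightarrow> ('q, 'a) ta" where
  "Prune A P = A\<lparr>trans_rules :=
     {\<tau> \<in> trans_rules A. \<not> (\<exists>\<tau>' \<in> trans_rules A. (\<tau>, \<tau>') \<in> P)}\<rparr>"

definition good_for_pruning :: "('q, 'a) ta \<Rightarrow> ('q, 'a) transition rel \<Rightarrow> bool" where
  "good_for_pruning A P \<longleftrightarrow> language (Prune A P) = language A"

end

(* Only the inclusion of L(A) in the pruned language needs work. By induction on the tree, every run
   of A can be replaced by a run of the pruned automaton with the same root state: replace the root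
   transition by a maximal one above it (componentwise in D) and hence not pruned. Since D is
   contained in downward trace inclusion, A still accepts each child subtree from the new child
   state, so the induction hypothesis applies to it. *)
theory Submission
  imports Defs
begin

section \<open>Closed trees and their subtrees\<close>

lemma closed_tree_child_iff:
  assumes "closed_tree \<Sigma> rk t" "v \<in> dom t"
  shows "v @ [i] \<in> dom t \<longleftrightarrow> i \<in> {1..rk (the (t v))}"
proof -
  have sub: "{i. v @ [i] \<in> dom t} \<subseteq> {1..rk (the (t v))}"
    using assms unfolding closed_tree_def is_tree_def by fastforce
  \<comment> \<open>Closedness only counts children; within a finite set of the same cardinality the
    count forces every index to occur.\<close>
  have "{i. v @ [i] \<in> dom t} = {1..rk (the (t v))}"
    using assms by (intro card_subset_eq sub) (simp_all add: closed_tree_def)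
  then show ?thesis by blast
qed

lemma is_tree_root:
  assumes "is_tree \<Sigma> rk t"
  shows "[] \<in> dom t"
proof -
  have "v \<in> dom t \<Longrightarrow> [] \<in> dom t" for v
    \<comment> \<open>Prefix closure drops the last entry of a node, hence the induction from the
      end of the list.\<close>
    by (induction v rule: rev_induct) (use assms in \<open>auto simp: is_tree_def\<close>)
  moreover have "\<exists>v. v \<in> dom t" using assms unfolding is_tree_def by blast
  ultimately show ?thesis by blast
qed

text \<open>The part at child \<open>i\<close>, re-rooted at \<open>[]\<close>. It is polymorphic in
  the labels so that one operation serves both trees and runs.\<close>

definition child_map :: "(node \<rightharpoonup> 'b) \<Rightarrow> nat \<Rightarrow> node \<rightharpoonup> 'b" where
  "child_map f i = (\<lambda>w. f (i # w))"

lemma dom_child_map [simp]: "dom (child_map f i) = (#) i -` dom f"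
  by (auto simp: child_map_def)

lemma mem_dom_child_map: "w \<in> dom (child_map f i) \<longleftrightarrow> i # w \<in> dom f"
  by simp

lemma ran_child_map: "ran (child_map f i) \<subseteq> ran f"
  by (auto simp: child_map_def ran_def)

lemma closed_tree_child_map:
  assumes t: "closed_tree \<Sigma> rk t" and i: "[i] \<in> dom t"
  shows "closed_tree \<Sigma> rk (child_map t i)"
proof -
  have tr: "finite (dom t)" "dom t \<subseteq> lists {1..}" "ran t \<subseteq> \<Sigma>"
    "\<And>v j. v @ [j] \<in> dom t \<Longrightarrow> v \<in> dom t \<and> j \<le> rk (the (t v))"
    and card: "\<And>v. v \<in> dom t \<Longrightarrow> card {j. v @ [j] \<in> dom t} = rk (the (t v))"
    using t unfolding closed_tree_def is_tree_def by blast+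
  show ?thesis
    unfolding closed_tree_def is_tree_def
  proof (intro conjI allI impI ballI)
    show "finite (dom (child_map t i))" using tr(1) by (simp add: finite_vimageI)
    show "dom (child_map t i) \<noteq> {}" using i by (simp add: vimage_def) blast
    show "dom (child_map t i) \<subseteq> lists {1..}"
    proof
      fix w assume "w \<in> dom (child_map t i)"
      then have "i # w \<in> dom t" by simp
      with tr(2) have "i # w \<in> lists {1..}" by (rule subsetD)
      then show "w \<in> lists {1..}" by simp
    qed
    show "ran (child_map t i) \<subseteq> \<Sigma>" using tr(3) ran_child_map by fast
  next
    fix w j assume "w @ [j] \<in> dom (child_map t i)"
    then have "(i # w) @ [j] \<in> dom t" by simp
    from tr(4)[OF this] show "w \<in> dom (child_map t i)" "j \<le> rk (the (child_map t i w))"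
      by (simp, simp add: child_map_def)
  next
    fix w assume "w \<in> dom (child_map t i)"
    then have "i # w \<in> dom t" by simp
    from card[OF this] show "card {j. w @ [j] \<in> dom (child_map t i)} = rk (the (child_map t i w))"
      by (simp add: child_map_def domIff)
  qed
qed

text \<open>Supplies the decreasing measure for the induction over trees: prefixing \<open>i\<close>
  embeds the nodes of the subtree injectively into those of \<open>t\<close> and misses the
  root.\<close>

lemma card_dom_child_map_less:
  assumes "is_tree \<Sigma> rk t"
  shows "card (dom (child_map t i)) < card (dom t)"
proof -
  have "(#) i ` dom (child_map t i) \<subseteq> dom t - {[]}" by auto
  moreover have "finite (dom t)" using assms by (simp add: is_tree_def)
  ultimately have "card ((#) i ` dom (child_map t i)) < card (dom t)"
    using is_tree_root[OF assms]
    by (metis Diff_subset card_Diff1_less card_mono finite_Diff order_le_less_trans)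
  then show ?thesis by (simp only: card_image[OF inj_on_Cons1])
qed

section \<open>Runs on closed trees: restriction and gluing\<close>

definition child_states :: "('q, 'a) ta \<Rightarrow> 'a tree \<Rightarrow> (node \<rightharpoonup> 'q) \<Rightarrow> node \<Rightarrow> 'q list" where
  "child_states A t \<pi> v =
     (if arity A (the (t v)) = 0 then [final A]
      else map (\<lambda>i. the (\<pi> (v @ [i]))) [1..<Suc (arity A (the (t v)))])"

lemma child_states_child_map:
  "child_states A (child_map t i) (child_map \<pi> i) w = child_states A t \<pi> (i # w)"
  by (simp add: child_states_def child_map_def)

text \<open>The additional child positions in the domain of a run already belong to a closed tree.
  As \<open>child_states\<close> absorbs the distinction between rank zero and positive rank, the
  condition at each node becomes a single membership.\<close>

lemma is_run_closed_tree_iff: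
  assumes "closed_tree (alphabet A) (arity A) t"
  shows "is_run A t \<pi> \<longleftrightarrow> dom \<pi> = dom t \<and> ran \<pi> \<subseteq> states A \<and>
    (\<forall>v \<in> dom t. (the (\<pi> v), the (t v), child_states A t \<pi> v) \<in> trans_rules A)"
proof -
  have "{v @ [i] | v i. v \<in> dom t \<and> 1 \<le> i \<and> i \<le> arity A (the (t v))} \<subseteq> dom t"
    using closed_tree_child_iff[OF assms] by auto
  then have "dom t \<union> {v @ [i] | v i. v \<in> dom t \<and> 1 \<le> i \<and> i \<le> arity A (the (t v))} = dom t"
    by (rule Un_absorb2)
  then show ?thesis
    unfolding is_run_def child_states_def Let_def by (auto simp del: upt_Suc)
qed

lemma is_run_child_map:
  assumes t: "closed_tree (alphabet A) (arity A) t" and i: "[i] \<in> dom t"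
    and run: "is_run A t \<pi>"
  shows "is_run A (child_map t i) (child_map \<pi> i)"
proof -
  have \<pi>: "dom \<pi> = dom t" "ran \<pi> \<subseteq> states A"
    "\<And>v. v \<in> dom t \<Longrightarrow> (the (\<pi> v), the (t v), child_states A t \<pi> v) \<in> trans_rules A"
    using run unfolding is_run_closed_tree_iff[OF t] by auto
  show ?thesis
    unfolding is_run_closed_tree_iff[OF closed_tree_child_map[OF t i]] child_states_child_map
  proof (intro conjI ballI)
    show "dom (child_map \<pi> i) = dom (child_map t i)"
      using \<pi>(1) by (intro set_eqI) simp
    show "ran (child_map \<pi> i) \<subseteq> states A" using \<pi>(2) ran_child_map[of \<pi> i] by blast
    show "(the (child_map \<pi> i w), the (child_map t i w), child_states A t \<pi> (i # w)) \<in> trans_rules A"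
      if "w \<in> dom (child_map t i)" for w
      using \<pi>(3)[of "i # w"] that unfolding mem_dom_child_map by (simp add: child_map_def)
  qed
qed

text \<open>Converse to restricting a run: runs on the child subtrees are glued below a root
  transition whose target tuple matches their root states. Children are counted from 1 and list
  positions from 0, hence \<open>i - 1\<close>.\<close>

lemma is_run_join:
  assumes t: "closed_tree (alphabet A) (arity A) t" and a: "t [] = Some a"
    and q: "q \<in> states A" "(q, a, qs) \<in> trans_rules A"
    and qs: "if arity A a = 0 then qs = [final A] else length qs = arity A a"
    and children: "\<And>i. [i] \<in> dom t \<Longrightarrow> \<exists>\<pi>. is_run A (child_map t i) \<pi> \<and> \<pi> [] = Some (qs ! (i - 1))"
  shows "\<exists>\<pi>. is_run A t \<pi> \<and> \<pi> [] = Some q"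
proof -
  have root: "[] \<in> dom t" using a by blast
  have child: "[i] \<in> dom t \<longleftrightarrow> i \<in> {1..arity A a}" for i
    using closed_tree_child_iff[OF t root, of i] a by simp
  have prefix: "[i] \<in> dom t" if "i # w \<in> dom t" for i w
    using that
  proof (induction w rule: rev_induct)
    case (snoc j w)
    then have "(i # w) @ [j] \<in> dom t" by simp
    then have "i # w \<in> dom t" using t unfolding closed_tree_def is_tree_def by blast
    then show ?case by (rule snoc.IH)
  qed
  obtain f where f: "\<And>i. [i] \<in> dom t \<Longrightarrow> is_run A (child_map t i) (f i)"
    "\<And>i. [i] \<in> dom t \<Longrightarrow> f i [] = Some (qs ! (i - 1))"
    using children by metis
  have dom_f: "dom (f i) = dom (child_map t i)" and ran_f: "ran (f i) \<subseteq> states A"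
    and trans_f: "\<And>v. v \<in> dom (child_map t i) \<Longrightarrow>
      (the (f i v), the (child_map t i v), child_states A (child_map t i) (f i) v) \<in> trans_rules A"
    if "[i] \<in> dom t" for i
    using f(1)[OF that] unfolding is_run_closed_tree_iff[OF closed_tree_child_map[OF t that]]
    by auto
  \<comment> \<open>Below absent children \<open>f i\<close> is unspecified; the value
    \<open>None\<close> there keeps the domain of \<open>\<pi>\<close> equal to that of
    \<open>t\<close>.\<close>
  define \<pi> where "\<pi> v = (case v of [] \<Rightarrow> Some q | i # w \<Rightarrow> if [i] \<in> dom t then f i w else None)" for v
  have \<pi>_child: "child_map \<pi> i = f i" if "[i] \<in> dom t" for i
    using that by (auto simp: \<pi>_def child_map_def)
  have "is_run A t \<pi>"
    unfolding is_run_closed_tree_iff[OF t]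
  proof (intro conjI ballI)
    have "v \<in> dom \<pi> \<longleftrightarrow> v \<in> dom t" for v
    proof (cases v)
      case Nil
      then show ?thesis using root by (simp add: \<pi>_def domIff)
    next
      case (Cons i w)
      show ?thesis
      proof (cases "[i] \<in> dom t")
        case True
        then show ?thesis using dom_f[OF True] \<pi>_child[OF True] Cons mem_dom_child_map by metis
      next
        case False
        then show ?thesis using prefix[of i w] Cons by (auto simp: \<pi>_def split: if_splits)
      qed
    qed
    then show "dom \<pi> = dom t" by blast
    show "ran \<pi> \<subseteq> states A"
    proof
      fix s assume "s \<in> ran \<pi>"
      then obtain v where "\<pi> v = Some s" by (auto simp: ran_def)
      then show "s \<in> states A"
        using q(1) ran_f by (cases v) (auto simp: \<pi>_def ran_def split: if_splits)
    qed
    fix v assume v: "v \<in> dom t"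
    show "(the (\<pi> v), the (t v), child_states A t \<pi> v) \<in> trans_rules A"
    proof (cases v)
      case Nil
      have "child_states A t \<pi> [] = qs"
      proof (cases "arity A a = 0")
        case True
        then show ?thesis using qs a by (simp add: child_states_def)
      next
        case False
        then show ?thesis using qs a child
          by (auto simp: child_states_def \<pi>_def f(2) simp del: upt_Suc intro!: nth_equalityI)
      qed
      then show ?thesis using Nil q(2) a by (simp add: \<pi>_def)
    next
      case (Cons i w)
      then have i: "[i] \<in> dom t" using prefix v by blast
      have "child_states A (child_map t i) (f i) w = child_states A t \<pi> (i # w)"
        using child_states_child_map[of A t i \<pi> w] \<pi>_child[OF i] by simp
      moreover have "f i w = \<pi> (i # w)" "child_map t i w = t (i # w)"
        using i by (auto simp: \<pi>_def child_map_def)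
      ultimately show ?thesis using trans_f[OF i, of w] v Cons by simp
    qed
  qed
  then show ?thesis by (auto simp: \<pi>_def)
qed

section \<open>Pruning and maximal transitions\<close>

lemma Prune_simps [simp]:
  "alphabet (Prune A P) = alphabet A" "arity (Prune A P) = arity A"
  "states (Prune A P) = states A" "initial (Prune A P) = initial A"
  "final (Prune A P) = final A"
  "trans_rules (Prune A P) = {\<tau> \<in> trans_rules A. \<not> (\<exists>\<tau>' \<in> trans_rules A. (\<tau>, \<tau>') \<in> P)}"
  by (simp_all add: Prune_def)

lemma is_run_Prune_imp: "is_run (Prune A P) t \<pi> \<Longrightarrow> is_run A t \<pi>"
  unfolding is_run_def Let_def Prune_simps mem_Collect_eq if_bool_eq_conj
  by (elim conjE, intro conjI ballI impI) (assumption | drule (1) bspec, simp only: simp_thms)+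

lemma trans_tuple_lift:
  assumes D: "trans D"
  shows "trans (tuple_lift (D - D\<inverse>) D)"
proof (rule transI)
  fix xs ys zs
  assume xy: "(xs, ys) \<in> tuple_lift (D - D\<inverse>) D" and yz: "(ys, zs) \<in> tuple_lift (D - D\<inverse>) D"
  have le: "(xs ! i, zs ! i) \<in> D" if "i < length xs" for i
    using xy yz that transD[OF D] unfolding tuple_lift_def by fastforce
  \<comment> \<open>Take a coordinate where the first step is strict. If \<open>zs ! i\<close> were
    below \<open>xs ! i\<close>, then \<open>ys ! i\<close>, being below \<open>zs ! i\<close>,
    would be below \<open>xs ! i\<close> too.\<close>
  obtain i where i: "i < length xs" "(ys ! i, xs ! i) \<notin> D"
    using xy unfolding tuple_lift_def by auto
  have "(ys ! i, zs ! i) \<in> D" using xy yz i(1) unfolding tuple_lift_def by auto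
  then have "(zs ! i, xs ! i) \<notin> D" using i(2) transD[OF D] by blast
  then show "(xs, zs) \<in> tuple_lift (D - D\<inverse>) D"
    using xy yz le i(1) unfolding tuple_lift_def by auto
qed

lemma irrefl_tuple_lift: "irrefl R \<Longrightarrow> irrefl (tuple_lift R D)"
  unfolding irrefl_def tuple_lift_def by auto

text \<open>With the source, the symbol and the tuple length fixed, finiteness of the state set
  leaves finitely many candidates, and the lifted strict order is irreflexive and transitive, so a
  maximal one exists.\<close>

lemma exists_maximal_transition:
  assumes A: "top_down_ta A" and D: "preorder_on (states A) D"
    and q: "(q, a, qs) \<in> trans_rules A"
  obtains rs where "(q, a, rs) \<in> trans_rules (Prune A (P_id A (D - D\<inverse>) D))"
    "length rs = length qs" "\<And>i. i < length qs \<Longrightarrow> (qs ! i, rs ! i) \<in> D"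
proof -
  have wf_rule: "set rs \<subseteq> states A" if "(p, b, rs) \<in> trans_rules A" for p b rs
    using A that unfolding top_down_ta_def by fastforce
  have D': "refl_on (states A) D" "trans D"
    using D by (auto simp: preorder_on_def)
  define L where "L = tuple_lift (D - D\<inverse>) D"
  \<comment> \<open>Maximality is sought only among tuples above \<open>qs\<close>, so that the
    result stays comparable with \<open>qs\<close> in every coordinate.\<close>
  define S where "S = {rs. (q, a, rs) \<in> trans_rules A \<and> length rs = length qs \<and>
    (\<forall>i < length qs. (qs ! i, rs ! i) \<in> D)}"
  have "S \<subseteq> {rs. set rs \<subseteq> states A \<and> length rs = length qs}"
    using wf_rule by (auto simp: S_def)
  moreover have "finite (states A)" using A by (simp add: top_down_ta_def)
  ultimately have fin: "finite S" by (metis finite_lists_length_eq finite_subset)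
  have "(qs ! i, qs ! i) \<in> D" if "i < length qs" for i
    using wf_rule[OF q] that by (intro refl_onD[OF D'(1)]) auto
  then have qs: "qs \<in> S" using q by (simp add: S_def)
  have "trans L" unfolding L_def by (rule trans_tuple_lift[OF D'(2)])
  moreover have "irrefl L" unfolding L_def by (rule irrefl_tuple_lift) (simp add: irrefl_def)
  ultimately have "asymp_on S (\<lambda>x y. (x, y) \<in> L)" "transp_on S (\<lambda>x y. (x, y) \<in> L)"
    unfolding asymp_on_def transp_on_def irrefl_def trans_def by blast+
  then have "\<exists>m\<in>S. \<forall>x\<in>S. x \<noteq> m \<longrightarrow> (m, x) \<notin> L"
    using Finite_Set.bex_max_element[OF fin] qs by blast
  \<comment> \<open>Irreflexivity covers the case \<open>x = m\<close> that the maximal element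
    leaves out.\<close>
  then obtain rs where rs: "rs \<in> S" "\<And>x. x \<in> S \<Longrightarrow> (rs, x) \<notin> L"
    using \<open>irrefl L\<close> by (metis irrefl_def)
  \<comment> \<open>Maximality in \<open>S\<close> is maximality among all competing transitions: by
    transitivity of \<open>D\<close>, a tuple above \<open>rs\<close> is also above
    \<open>qs\<close> and thus lies in \<open>S\<close>.\<close>
  have False if "(q, a, rs') \<in> trans_rules A" "(rs, rs') \<in> L" for rs'
  proof -
    have "rs' \<in> S"
      using rs(1) that transD[OF D'(2)] unfolding S_def L_def tuple_lift_def by fastforce
    then show False using rs(2) that(2) by blast
  qed
  then have "(q, a, rs) \<in> trans_rules (Prune A (P_id A (D - D\<inverse>) D))"
    using rs(1) by (auto simp: S_def L_def P_id_def)
  then show ?thesis using that rs(1) by (auto simp: S_def)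
qed

lemma run_Prune_exists:
  assumes A: "top_down_ta A" and D: "preorder_on (states A) D" "D \<subseteq> dw_trace_incl A"
    and "closed_tree (alphabet A) (arity A) t" "is_run A t \<pi>" "\<pi> [] = Some q"
  shows "\<exists>\<pi>'. is_run (Prune A (P_id A (D - D\<inverse>) D)) t \<pi>' \<and> \<pi>' [] = Some q"
  using assms(4-)
\<comment> \<open>The run and its root state vary: on a subtree the hypothesis is applied to a run
  obtained from trace inclusion, which need not be a restriction of \<open>\<pi>\<close>.\<close>
proof (induction "card (dom t)" arbitrary: t \<pi> q rule: less_induct)
  case less
  let ?B = "Prune A (P_id A (D - D\<inverse>) D)"
  note t = less.prems(1)
  have tree: "is_tree (alphabet A) (arity A) t" using t by (simp add: closed_tree_def)
  obtain a where a: "t [] = Some a" using is_tree_root[OF tree] by blast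
  define qs where "qs = child_states A t \<pi> []"
  have q: "(q, a, qs) \<in> trans_rules A" "q \<in> states A"
    using less.prems(2,3) a unfolding is_run_closed_tree_iff[OF t] qs_def
    by (force, auto simp: ran_def)
  obtain rs where rs: "(q, a, rs) \<in> trans_rules ?B" "length rs = length qs"
    "\<And>i. i < length qs \<Longrightarrow> (qs ! i, rs ! i) \<in> D"
    using exists_maximal_transition[OF A D(1) q(1)] by blast
  have "(q, a, rs) \<in> trans_rules A" using rs(1) by simp
  then have len: "if arity A a = 0 then rs = [final A] else length rs = arity A a"
    using A unfolding top_down_ta_def by fastforce
  have child: "\<exists>\<pi>'. is_run ?B (child_map t i) \<pi>' \<and> \<pi>' [] = Some (rs ! (i - 1))"
    if i: "[i] \<in> dom t" for i
  proof -
    have i_le: "1 \<le> i" "i \<le> arity A a"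
      using closed_tree_child_iff[OF t, of "[]" i] a i by auto
    have "[i] \<in> dom \<pi>" using i less.prems(2) by (auto simp: is_run_closed_tree_iff[OF t])
    then have "child_map \<pi> i [] = Some (qs ! (i - 1))"
      using i_le a by (auto simp: qs_def child_states_def child_map_def simp del: upt_Suc)
    \<comment> \<open>The existence of child \<open>i\<close> forces positive rank, which rules out
      the tuple \<open>[final A]\<close> of a rank zero symbol.\<close>
    moreover have "i - 1 < length qs" using len i_le rs(2) by (auto split: if_splits)
    then have "(qs ! (i - 1), rs ! (i - 1)) \<in> dw_trace_incl A" using rs(3) D(2) by blast
    \<comment> \<open>Trace inclusion refers to \<open>A\<close>, so \<open>\<pi>i\<close> may still
      use pruned transitions; the induction hypothesis then replaces it by a run of
      \<open>?B\<close>.\<close>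
    ultimately obtain \<pi>i where "is_run A (child_map t i) \<pi>i" "\<pi>i [] = Some (rs ! (i - 1))"
      using is_run_child_map[OF t i less.prems(2)] closed_tree_child_map[OF t i]
      unfolding dw_trace_incl_def by blast
    then show ?thesis
      using less.hyps[OF card_dom_child_map_less[OF tree] closed_tree_child_map[OF t i]] by blast
  qed
  show ?case
  proof (rule is_run_join)
    show "t [] = Some a" "(q, a, rs) \<in> trans_rules ?B" by (fact a rs(1))+
  qed (use t q(2) len child in simp_all)
qed

theorem theorem1:
  fixes A :: "('q, 'a) ta" and R D :: "'q rel"
  assumes "top_down_ta A"
    and "strict_partial_order_on (states A) R"
    and "R \<subseteq> dw_trace_incl A"
    and "associated_preorder_on (states A) R D"
    and "D \<subseteq> dw_trace_incl A"
  shows "good_for_pruning A (P_id A R D)"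
proof -
  \<comment> \<open>The strict order is recovered from its preorder, so the results stated for
    \<open>D - D\<inverse>\<close> apply to \<open>R\<close>.\<close>
  have R: "R = D - D\<inverse>" and D: "preorder_on (states A) D"
    using assms(4) by (auto simp: associated_preorder_on_def)
  have "language A \<subseteq> language (Prune A (P_id A R D))"
    unfolding language_def R Prune_simps
    using run_Prune_exists[OF assms(1) D assms(5)] by blast
  moreover have "language (Prune A (P_id A R D)) \<subseteq> language A"
    unfolding language_def Prune_simps using is_run_Prune_imp by blast
  ultimately show ?thesis by (simp add: good_for_pruning_def)
qed

end
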